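(* Let $V$ be a real separable Hilbert space and let $a,b,m$ be symmetric bilinear forms on $V$ such that $a$ is continuous and $V$-coercive, $b$ is weakly continuous, and $m$ is weakly continuous with $m(u,u)>0$ for all nonzero $u\in V$. Let $\lambda\in\mathbb{R}$, and let $\tau>0$ be large enough that $a_{\lambda,\tau}(u,u)\ge\frac12 a(u,u)$ for all $u\in V$, where $a_{\lambda,\tau}:=a-\lambda b+\tau m$. Let $(\mu_n(\lambda))_{n\in\mathbb{N}}$ and $(e_{\lambda n})_{n\in\mathbb{N}}$ be the sequences of values and maximizers produced by the iterative construction described in the context. Then each $\mu_n(\lambda)$ is of finite multiplicity, $$-\infty<\mu_1(\lambda)\le\mu_2(\lambda)\le\cdots\to+\infty,$$ and $\{e_{\lambda n}:n\in\mathbb{N}\}$ is an $a_{\lambda,\tau}$-orthonormal basis of $V$ consisting of vectors satisfying $$a(e_{\lambda n},v)=\lambda\,b(e_{\lambda n},v)+\mu_n(\lambda)\,m(e_{\lambda n},v)\qquad\text{for all }v\in V.$$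
   Context: "$a$ is continuous and $V$-coercive" means there are constants $0<\kappa_1\le\kappa_2<\infty$ with $\kappa_1\|u\|^2\le a(u,u)\le\kappa_2\|u\|^2$ for all $u\in V$. A symmetric bilinear form $b$ on $V$ is weakly continuous if $u_j\rightharpoonup u$ and $v_j\rightharpoonup v$ weakly in $V$ imply $b(u_j,v_j)\to b(u,v)$. With $\tau$ chosen as in the claim (such a $\tau$ exists for every $\lambda$), $a_{\lambda,\tau}$ is an inner product on $V$ equivalent to the given one. Construction. Let $C_{1,\lambda,\tau}:=\{u\in V: a_{\lambda,\tau}(u,u)\le1\}$. Let $e_{\lambda1}$ be a maximizer of $u\mapsto m(u,u)$ on $C_{1,\lambda,\tau}$ and define $\mu_1(\lambda)$ by $\frac{1}{\mu_1(\lambda)+\tau}=\sup_{u\in C_{1,\lambda,\tau}}m(u,u)$. Given $e_{\lambda1},\dots,e_{\lambda k}$, let $C_{k+1,\lambda,\tau}:=\{u\in C_{1,\lambda,\tau}: a_{\lambda,\tau}(u,e_{\lambda n})=0\text{ for }n=1,\dots,k\}$, let $e_{\lambda,k+1}$ be a maximizer of $m(u,u)$ on $C_{k+1,\lambda,\tau}$, and define $\mu_{k+1}(\lambda)$ by $\frac{1}{\mu_{k+1}(\lambda)+\tau}=\sup_{u\in C_{k+1,\lambda,\tau}}m(u,u)$. The values $\mu_n(\lambda)$ are thus listed in increasing order and repeated according to multiplicity. The value $\mu_n(\lambda)$ being of finite multiplicity means that the space of $u\in V$ with $a(u,v)-\lambda b(u,v)=\mu_n(\lambda)m(u,v)$ for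 all $v\in V$ is finite dimensional. *)

theory Defs
  imports "HOL-Analysis.Analysis"
begin

definition symmetric_bilinear_form :: "('a::real_vector \<Rightarrow> 'a \<Rightarrow> real) \<Rightarrow> bool" where
  "symmetric_bilinear_form f \<longleftrightarrow> bilinear f \<and> (\<forall>u v. f u v = f v u)"

definition continuous_coercive :: "('a::real_normed_vector \<Rightarrow> 'a \<Rightarrow> real) \<Rightarrow> bool" where
  "continuous_coercive a \<longleftrightarrow>
     (\<exists>\<kappa>\<^sub>1 \<kappa>\<^sub>2. 0 < \<kappa>\<^sub>1 \<and> \<kappa>\<^sub>1 \<le> \<kappa>\<^sub>2 \<and>
        (\<forall>u. \<kappa>\<^sub>1 * (norm u)\<^sup>2 \<le> a u u \<and> a u u \<le> \<kappa>\<^sub>2 * (norm u)\<^sup>2))"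

definition weakly_converges :: "(nat \<Rightarrow> 'a::real_normed_vector) \<Rightarrow> 'a \<Rightarrow> bool" where
  "weakly_converges x l \<longleftrightarrow>
     (\<forall>\<phi> :: 'a \<Rightarrow> real. bounded_linear \<phi> \<longrightarrow> (\<lambda>j. \<phi> (x j)) \<longlonglongrightarrow> \<phi> l)"

definition weakly_continuous_form :: "('a::real_normed_vector \<Rightarrow> 'a \<Rightarrow> real) \<Rightarrow> bool" where
  "weakly_continuous_form f \<longleftrightarrow>
     (\<forall>x y u v. weakly_converges x u \<longrightarrow> weakly_converges y v \<longrightarrow>
        (\<lambda>j. f (x j) (y j)) \<longlonglongrightarrow> f u v)"

definition shifted_form ::
  "('a \<Rightarrow> 'a \<Rightarrow> real) \<Rightarrow> ('a \<Rightarrow> 'a \<Rightarrow> real) \<Rightarrow> ('a \<Rightarrow> 'a \<Rightarrow> real) \<Rightarrow> real \<Rightarrow> real \<Rightarrow> 'a \<Rightarrow> 'a \<Rightarrow> real" where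
  "shifted_form a b m lam \<tau> u v = a u v - lam * b u v + \<tau> * m u v"

(* Sequences are indexed from 0: index n here is the (n+1)-st step of the construction. *)
definition constraint_set :: "('a \<Rightarrow> 'a \<Rightarrow> real) \<Rightarrow> (nat \<Rightarrow> 'a) \<Rightarrow> nat \<Rightarrow> 'a set" where
  "constraint_set A e n = {u. A u u \<le> 1 \<and> (\<forall>k<n. A u (e k) = 0)}"

(* "\<mu> n + \<tau> \<noteq> 0" excludes the convention 1 / 0 = 0, under which the second equation
   would be satisfiable when the supremum is 0 (the constraint set being {0}, which happens
   exactly when the space is finite-dimensional and has been exhausted). *)
definition iterative_construction ::
  "('a \<Rightarrow> 'a \<Rightarrow> real) \<Rightarrow> ('a \<Rightarrow> 'a \<Rightarrow> real) \<Rightarrow> real \<Rightarrow> (nat \<Rightarrow> 'a) \<Rightarrow> (nat \<Rightarrow> real) \<Rightarrow> bool" where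
  "iterative_construction A m \<tau> e \<mu> \<longleftrightarrow>
     (\<forall>n. is_arg_max (\<lambda>u. m u u) (\<lambda>u. u \<in> constraint_set A e n) (e n) \<and>
          \<mu> n + \<tau> \<noteq> 0 \<and>
          1 / (\<mu> n + \<tau>) = (SUP u\<in>constraint_set A e n. m u u))"

definition eigenspace ::
  "('a \<Rightarrow> 'a \<Rightarrow> real) \<Rightarrow> ('a \<Rightarrow> 'a \<Rightarrow> real) \<Rightarrow> ('a \<Rightarrow> 'a \<Rightarrow> real) \<Rightarrow> real \<Rightarrow> real \<Rightarrow> 'a set" where
  "eigenspace a b m lam \<nu> = {u. \<forall>v. a u v - lam * b u v = \<nu> * m u v}"

definition finite_dimensional :: "'a::real_vector set \<Rightarrow> bool" where
  "finite_dimensional E \<longleftrightarrow> (\<exists>B. finite B \<and> span B = E)"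

(* The closure is taken in the norm of the ambient space; for A = shifted_form ... with a
   coercive and \<tau> large, A is an inner product inducing an equivalent norm. *)
definition form_orthonormal_basis ::
  "('a::real_normed_vector \<Rightarrow> 'a \<Rightarrow> real) \<Rightarrow> (nat \<Rightarrow> 'a) \<Rightarrow> bool" where
  "form_orthonormal_basis A e \<longleftrightarrow>
     (\<forall>i j. A (e i) (e j) = (if i = j then 1 else 0)) \<and> closure (span (range e)) = UNIV"

end

theory Submission
  imports Defs
begin

text \<open>
  Write \<open>A\<close> for the shifted form \<open>a - lam b + \<tau> m\<close> and \<open>M n = m (e n) (e n)\<close> for the \<open>n\<close>-th maximum, so
  that \<open>M n = 1 / (\<mu> n + \<tau>)\<close>.  Adding \<open>\<tau> m\<close> to both sides turns the eigenvalue equation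
  \<open>a u v - lam b u v = \<mu> m u v\<close> into \<open>m u v = M A u v\<close> with \<open>M = 1 / (\<mu> + \<tau>)\<close>, which makes the theorem the
  spectral theorem for the compact positive operator that represents \<open>m\<close> with respect to the inner
  product \<open>A\<close>.  The proof works with forms only and never introduces this operator.

  A weakly continuous form is bounded, hence so is \<open>A\<close>.  It is also coercive, because \<open>\<tau>\<close> is so large
  that \<open>A\<close> dominates \<open>a / 2\<close>; thus \<open>A\<close> is an inner product with an equivalent norm.

  By homogeneity, \<open>M n A - m\<close> is positive semidefinite on the \<open>A\<close>-orthogonal
  complement of \<open>e 0, \<dots>, e (n - 1)\<close> and vanishes at \<open>e n\<close>.  The Cauchy-Schwarz inequality for this
  semidefinite form is the Euler-Lagrange equation \<open>m (e n) v = M n A (e n) v\<close>, at first for \<open>v\<close> in the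
  complement; since the \<open>e k\<close> are orthogonal for \<open>m\<close> as well, it then holds for all \<open>v\<close>
  (\<open>euler_lagrange\<close>).

  By Bessel's inequality an \<open>A\<close>-orthonormal sequence tends weakly to zero, hence
  \<open>M n = m (e n) (e n)\<close> tends to \<open>0\<close> and \<open>\<mu>\<close> tends to infinity.  A vector \<open>w\<close> that is orthogonal to
  all \<open>e n\<close> satisfies \<open>m w w \<le> M n A w w\<close> for every \<open>n\<close>, so \<open>m w w = 0\<close> and \<open>w = 0\<close>
  (\<open>orthogonal_to_all_imp_zero\<close>).  Both remaining claims follow from this: a Fourier
  series, convergent by completeness, has no choice but to converge to the vector it was
  formed from; and an eigenvector for \<open>\<mu> n\<close>, being orthogonal to every \<open>e k\<close> with
  \<open>\<mu> k \<noteq> \<mu> n\<close>, lies in the span of the finitely many others.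
\<close>

section \<open>Symmetric bilinear forms\<close>

locale symmetric_form =
  fixes q :: "'a::real_vector \<Rightarrow> 'a \<Rightarrow> real"
  assumes symmetric_bilinear: "symmetric_bilinear_form q"
begin

lemma bilinear: "bilinear q"
  using symmetric_bilinear by (simp add: symmetric_bilinear_form_def)

lemma commute: "q u v = q v u"
  using symmetric_bilinear by (simp add: symmetric_bilinear_form_def)

lemma linear_left: "linear (\<lambda>u. q u v)"
  using bilinear by (simp add: bilinear_def)

lemmas form_simps =
  bilinear_ladd[OF bilinear] bilinear_radd[OF bilinear]
  bilinear_lmul[OF bilinear] bilinear_rmul[OF bilinear]
  bilinear_lsub[OF bilinear] bilinear_rsub[OF bilinear]
  bilinear_lzero[OF bilinear] bilinear_rzero[OF bilinear]

lemma sum_left: "q (\<Sum>k\<in>I. c k *\<^sub>R x k) v = (\<Sum>k\<in>I. c k * q (x k) v)"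
  using linear_sum[OF linear_left, of "\<lambda>k. c k *\<^sub>R x k" I v] by (simp add: form_simps)

text \<open>
  This is meant for the form \<open>M n A - m\<close>, which in general is semidefinite only on a subspace and is
  evaluated at one of its null vectors \<open>u\<close>, where the inequality says that \<open>q u v = 0\<close>.
\<close>

lemma Cauchy_Schwarz_on:
  assumes S: "subspace S" and nonneg: "\<And>x. x \<in> S \<Longrightarrow> 0 \<le> q x x"
    and u: "u \<in> S" and v: "v \<in> S"
  shows "(q u v)\<^sup>2 \<le> q u u * q v v"
proof (cases "q v v = 0")
  case True
  have "q u v = 0"
  proof (rule ccontr)
    assume nz: "q u v \<noteq> 0"
    \<comment> \<open>On the line \<open>u + t v\<close> the form is affine in \<open>t\<close>; this \<open>t\<close> is where it takes the value \<open>-1\<close>.\<close>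
    define t where "t = - (q u u + 1) / (2 * q u v)"
    have "q (u + t *\<^sub>R v) (u + t *\<^sub>R v) = q u u + 2 * t * q u v"
      using True commute[of v u] by (simp add: form_simps algebra_simps)
    also have "\<dots> = -1"
      using nz by (simp add: t_def field_simps)
    finally show False
      using nonneg[of "u + t *\<^sub>R v"] S u v by (simp add: subspace_add subspace_scale)
  qed
  then show ?thesis using True by simp
next
  case False
  then have pos: "0 < q v v" using nonneg[OF v] by simp
  \<comment> \<open>\<open>w\<close> is a multiple of the component of \<open>u\<close> that is orthogonal to \<open>v\<close>.\<close>
  define w where "w = q v v *\<^sub>R u - q u v *\<^sub>R v"
  have "q w w = q v v * (q u u * q v v - (q u v)\<^sup>2)"
    using commute[of v u]
    by (simp add: w_def form_simps algebra_simps power2_eq_square)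
  moreover have "w \<in> S" using S u v by (simp add: w_def subspace_diff subspace_scale)
  ultimately have "0 \<le> q v v * (q u u * q v v - (q u v)\<^sup>2)" using nonneg by metis
  then show ?thesis using pos by (simp add: zero_le_mult_iff)
qed

end

lemma symmetric_bilinear_form_combination:
  assumes "symmetric_bilinear_form f" "symmetric_bilinear_form g"
  shows "symmetric_bilinear_form (\<lambda>u v. s * f u v + t * g u v)"
proof -
  interpret f: symmetric_form f using assms(1) by unfold_locales
  interpret g: symmetric_form g using assms(2) by unfold_locales
  have "s * f u v + t * g u v = s * f v u + t * g v u" for u v
    using f.commute[of u v] g.commute[of u v] by simp
  then show ?thesis
    unfolding symmetric_bilinear_form_def bilinear_def
    by (auto intro!: linearI simp: f.form_simps g.form_simps algebra_simps)
qed

lemma symmetric_bilinear_form_shifted: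
  assumes "symmetric_bilinear_form a" "symmetric_bilinear_form b" "symmetric_bilinear_form m"
  shows "symmetric_bilinear_form (shifted_form a b m lam \<tau>)"
proof -
  have "shifted_form a b m lam \<tau> =
      (\<lambda>u v. 1 * (1 * a u v + (- lam) * b u v) + \<tau> * m u v)"
    by (simp add: shifted_form_def fun_eq_iff)
  then show ?thesis
    using assms by (simp only: symmetric_bilinear_form_combination)
qed

section \<open>Weakly continuous forms are bounded\<close>

text \<open>
  Unboundedness would give vectors \<open>x n\<close> tending to zero in norm, hence weakly, along which
  \<open>f (x n) (x n)\<close> stays away from zero.
\<close>

lemma weakly_continuous_form_bounded:
  assumes f: "symmetric_bilinear_form f" and wc: "weakly_continuous_form f"
  obtains K where "\<And>u. \<bar>f u u\<bar> \<le> K * (norm u)\<^sup>2"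
proof -
  interpret f: symmetric_form f using f by unfold_locales
  have "\<exists>K. \<forall>u. \<bar>f u u\<bar> \<le> K * (norm u)\<^sup>2"
  proof (rule ccontr)
    assume "\<not> ?thesis"
    then have "\<forall>n::nat. \<exists>u. real (Suc n) * (norm u)\<^sup>2 < \<bar>f u u\<bar>"
      by (meson not_le)
    then obtain u where u: "\<And>n::nat. real (Suc n) * (norm (u n))\<^sup>2 < \<bar>f (u n) (u n)\<bar>"
      by metis
    have nz: "u n \<noteq> 0" for n
      using u[of n] by (auto simp: f.form_simps)
    define r where "r n = 1 / (sqrt (real (Suc n)) * norm (u n))" for n
    have r2: "(r n)\<^sup>2 = 1 / (real (Suc n) * (norm (u n))\<^sup>2)" for n
      by (simp add: r_def power_divide power_mult_distrib)
    have large: "1 < \<bar>f (r n *\<^sub>R u n) (r n *\<^sub>R u n)\<bar>" for n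
    proof -
      have "\<bar>f (r n *\<^sub>R u n) (r n *\<^sub>R u n)\<bar> = (r n)\<^sup>2 * \<bar>f (u n) (u n)\<bar>"
        by (simp add: f.form_simps abs_mult power2_eq_square)
      also have "1 < \<dots>"
        using u[of n] nz[of n] by (simp add: r2 pos_less_divide_eq del: of_nat_Suc)
      finally show ?thesis .
    qed
    have "norm (r n *\<^sub>R u n) = 1 / sqrt (real (Suc n))" for n
      using nz[of n] by (simp add: r_def)
    moreover have "(\<lambda>n. 1 / sqrt (real (Suc n))) \<longlonglongrightarrow> 0"
      by (intro tendsto_divide_0[OF tendsto_const] filterlim_at_top_imp_at_infinity
          filterlim_compose[OF sqrt_at_top] filterlim_compose[OF filterlim_real_sequentially]
          filterlim_Suc)
    ultimately have "(\<lambda>n. r n *\<^sub>R u n) \<longlonglongrightarrow> 0"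
      by (metis (no_types, lifting) ext tendsto_norm_zero_cancel)
    then have "weakly_converges (\<lambda>n. r n *\<^sub>R u n) 0"
      unfolding weakly_converges_def using bounded_linear.tendsto by blast
    with wc have "(\<lambda>n. f (r n *\<^sub>R u n) (r n *\<^sub>R u n)) \<longlonglongrightarrow> f 0 0"
      by (simp add: weakly_continuous_form_def)
    then have "(\<lambda>n. \<bar>f (r n *\<^sub>R u n) (r n *\<^sub>R u n)\<bar>) \<longlonglongrightarrow> 0"
      using f.form_simps by (simp add: tendsto_rabs_zero)
    then have "1 \<le> (0::real)"
      by (rule LIMSEQ_le_const) (use large less_imp_le in blast)
    then show False by simp
  qed
  then show ?thesis using that by blast
qed

section \<open>Orthonormal sequences for an equivalent inner product\<close>

locale equivalent_inner_product = symmetric_form A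
  for A :: "'a::real_normed_vector \<Rightarrow> 'a \<Rightarrow> real" +
  fixes c K :: real
  assumes c_pos: "0 < c"
    and coercive: "c * (norm u)\<^sup>2 \<le> A u u"
    and bounded: "A u u \<le> K * (norm u)\<^sup>2"
begin

lemma nonneg: "0 \<le> A u u"
  using coercive[of u] c_pos by (meson mult_nonneg_nonneg less_imp_le order_trans zero_le_power2)

lemma pos: "u \<noteq> 0 \<Longrightarrow> 0 < A u u"
  using coercive[of u] c_pos by (smt (verit) mult_pos_pos zero_less_norm_iff zero_less_power)

lemma tendsto_form:
  assumes "x \<longlonglongrightarrow> l"
  shows "(\<lambda>n. A (x n) v) \<longlonglongrightarrow> A l v"
proof -
  have bound: "(A (x n) v - A l v)\<^sup>2 \<le> K * (norm (x n - l))\<^sup>2 * A v v" for n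
  proof -
    have "(A (x n) v - A l v)\<^sup>2 = (A (x n - l) v)\<^sup>2"
      by (simp add: form_simps)
    also have "\<dots> \<le> A (x n - l) (x n - l) * A v v"
      using Cauchy_Schwarz_on[OF subspace_UNIV] nonneg by blast
    also have "\<dots> \<le> K * (norm (x n - l))\<^sup>2 * A v v"
      by (intro mult_right_mono bounded nonneg)
    finally show ?thesis .
  qed
  have "(\<lambda>n. K * (norm (x n - l))\<^sup>2 * A v v) \<longlonglongrightarrow> K * (norm (l - l))\<^sup>2 * A v v"
    by (intro tendsto_intros assms)
  then have "(\<lambda>n. K * (norm (x n - l))\<^sup>2 * A v v) \<longlonglongrightarrow> 0" by simp
  then have "(\<lambda>n. (A (x n) v - A l v)\<^sup>2) \<longlonglongrightarrow> 0"
    by (rule tendsto_sandwich[OF always_eventually always_eventually tendsto_const, rotated -1])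
      (use bound in auto)
  then have "(\<lambda>n. sqrt ((A (x n) v - A l v)\<^sup>2)) \<longlonglongrightarrow> sqrt 0"
    by (rule tendsto_real_sqrt)
  then show ?thesis
    by (simp add: tendsto_rabs_zero_iff LIM_zero_iff)
qed

end

locale orthonormal_sequence = equivalent_inner_product A c K
  for A :: "'a::real_normed_vector \<Rightarrow> 'a \<Rightarrow> real" and c K +
  fixes e :: "nat \<Rightarrow> 'a"
  assumes orthonormal: "A (e i) (e j) = (if i = j then 1 else 0)"
begin

lemma coefficient:
  assumes "finite I"
  shows "A (\<Sum>k\<in>I. x k *\<^sub>R e k) (e j) = (if j \<in> I then x j else 0)"
  using assms by (simp add: sum_left orthonormal if_distrib[of "(*) _"] cong: if_cong)

lemma Pythagoras:
  assumes "finite I"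
  shows "A (\<Sum>k\<in>I. x k *\<^sub>R e k) (\<Sum>k\<in>I. x k *\<^sub>R e k) = (\<Sum>k\<in>I. (x k)\<^sup>2)"
proof -
  have "A (\<Sum>k\<in>I. x k *\<^sub>R e k) (\<Sum>k\<in>I. x k *\<^sub>R e k)
      = (\<Sum>j\<in>I. x j * A (\<Sum>k\<in>I. x k *\<^sub>R e k) (e j))"
    by (subst sum_left) (intro sum.cong refl arg_cong2[where f = "(*)"] commute)
  also have "\<dots> = (\<Sum>j\<in>I. (x j)\<^sup>2)"
    using assms by (intro sum.cong) (simp_all add: coefficient power2_eq_square)
  finally show ?thesis .
qed

text \<open>
  Bessel's inequality for a functional instead of a vector, which avoids representing \<open>\<phi>\<close>:
  for \<open>y = (\<Sum>k\<in>I. \<phi> (e k) *\<^sub>R e k)\<close> both \<open>\<phi> y\<close> and \<open>A y y\<close> equal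
  \<open>S = (\<Sum>k\<in>I. (\<phi> (e k))\<^sup>2)\<close>, so \<open>(\<phi> y)\<^sup>2 \<le> L * A y y\<close> reads \<open>S\<^sup>2 \<le> L * S\<close>.
\<close>

lemma Bessel:
  assumes "linear \<phi>" and bound: "\<And>u. (\<phi> u)\<^sup>2 \<le> L * A u u"
  shows "summable (\<lambda>k. (\<phi> (e k))\<^sup>2)"
proof -
  have partial: "(\<Sum>k<n. (\<phi> (e k))\<^sup>2) \<le> L" for n
  proof -
    define y where "y = (\<Sum>k<n. \<phi> (e k) *\<^sub>R e k)"
    define S where "S = (\<Sum>k<n. (\<phi> (e k))\<^sup>2)"
    have "\<phi> y = S"
      using assms(1) by (simp add: y_def S_def linear_sum linear_scale power2_eq_square)
    moreover have "A y y = S"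
      unfolding y_def S_def by (rule Pythagoras) simp
    ultimately have "S * S \<le> L * S"
      using bound[of y] by (simp add: power2_eq_square)
    moreover have "0 \<le> S" by (simp add: S_def sum_nonneg)
    moreover have "0 \<le> L"
      using bound[of "e 0"] orthonormal[of 0 0] by (simp add: order_trans[OF zero_le_power2])
    ultimately have "S \<le> L"
      by (cases "S = 0") auto
    then show ?thesis by (simp add: S_def)
  qed
  show ?thesis
    by (rule summableI_nonneg_bounded[of _ L]) (use partial in auto)
qed

lemma weakly_converges_zero: "weakly_converges e 0"
  unfolding weakly_converges_def
proof (intro allI impI)
  fix \<phi> :: "'a \<Rightarrow> real"
  assume \<phi>: "bounded_linear \<phi>"
  then interpret bounded_linear \<phi> .
  obtain B where B: "\<And>u. norm (\<phi> u) \<le> norm u * B"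
    using bounded by blast
  have "(\<phi> u)\<^sup>2 \<le> (B\<^sup>2 / c) * A u u" for u
  proof -
    have "(\<phi> u)\<^sup>2 \<le> (norm u * B)\<^sup>2"
      using B[of u] by (intro abs_le_square_iff[THEN iffD1]) auto
    also have "\<dots> = (B\<^sup>2 / c) * (c * (norm u)\<^sup>2)"
      using c_pos by (simp add: power_mult_distrib)
    also have "\<dots> \<le> (B\<^sup>2 / c) * A u u"
      using c_pos by (intro mult_left_mono coercive) auto
    finally show ?thesis .
  qed
  then have "(\<lambda>k. (\<phi> (e k))\<^sup>2) \<longlonglongrightarrow> 0"
    by (intro summable_LIMSEQ_zero Bessel[OF linear_axioms])
  then have "(\<lambda>k. \<phi> (e k)) \<longlonglongrightarrow> 0"
    using tendsto_real_sqrt[of _ 0] by (force simp: tendsto_rabs_zero_iff)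
  then show "(\<lambda>k. \<phi> (e k)) \<longlonglongrightarrow> \<phi> 0"
    by simp
qed

end

text \<open>
  Coercivity bounds the norm of a block of the series by the corresponding block of the sum of
  squares in Bessel's inequality, so the partial sums are Cauchy.  The coefficients of the limit are
  those of \<open>u\<close> by continuity of \<open>A\<close>, so \<open>s\<close> is the orthogonal projection of \<open>u\<close> onto the closed span.
\<close>

lemma (in orthonormal_sequence) Fourier_series_convergent:
  assumes complete: "complete (UNIV :: 'a set)"
  obtains s where "(\<lambda>n. \<Sum>k<n. A u (e k) *\<^sub>R e k) \<longlonglongrightarrow> s"
    and "\<And>j. A s (e j) = A u (e j)"
proof -
  let ?s = "\<lambda>n. \<Sum>k<n. A u (e k) *\<^sub>R e k"
  have "(A u v)\<^sup>2 \<le> A u u * A v v" for v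
    using Cauchy_Schwarz_on[OF subspace_UNIV] nonneg by blast
  moreover have "linear (A u)"
    using bilinear by (simp add: bilinear_def)
  ultimately have squares: "summable (\<lambda>k. (A u (e k))\<^sup>2)"
    by (intro Bessel)
  have "Cauchy ?s"
  proof (rule CauchyI)
    fix r :: real assume r: "0 < r"
    then have "0 < c * r\<^sup>2" using c_pos by simp
    then obtain N where N: "\<And>i j. N \<le> i \<Longrightarrow> norm (\<Sum>k\<in>{i..<j}. (A u (e k))\<^sup>2) < c * r\<^sup>2"
      using squares unfolding summable_Cauchy by meson
    have step: "norm (?s j - ?s i) < r" if "N \<le> i" "i \<le> j" for i j
    proof -
      have d: "?s j - ?s i = (\<Sum>k\<in>{i..<j}. A u (e k) *\<^sub>R e k)"
        using that(2) sum_diff_nat_ivl[of 0 i j "\<lambda>k. A u (e k) *\<^sub>R e k"]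
        by (simp add: atLeast0LessThan)
      have "c * (norm (?s j - ?s i))\<^sup>2 \<le> (\<Sum>k\<in>{i..<j}. (A u (e k))\<^sup>2)"
        using coercive[of "?s j - ?s i"] unfolding d by (simp add: Pythagoras)
      also have "\<dots> < c * r\<^sup>2" using N[OF that(1), of j] by simp
      finally have "(norm (?s j - ?s i))\<^sup>2 < r\<^sup>2" using c_pos by simp
      then show ?thesis using r by (simp add: power2_less_imp_less)
    qed
    show "\<exists>N. \<forall>i\<ge>N. \<forall>j\<ge>N. norm (?s i - ?s j) < r"
      by (metis step linorder_le_cases norm_minus_commute)
  qed
  then obtain s where s: "?s \<longlonglongrightarrow> s"
    using complete unfolding complete_def by blast
  have "A s (e j) = A u (e j)" for j
  proof -
    have "\<forall>\<^sub>F n in sequentially. A (?s n) (e j) = A u (e j)"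
      using eventually_gt_at_top[of j] by eventually_elim (simp add: coefficient)
    then have "(\<lambda>n. A (?s n) (e j)) \<longlonglongrightarrow> A u (e j)"
      by (simp add: tendsto_eventually)
    then show ?thesis
      using tendsto_form[OF s] LIMSEQ_unique by blast
  qed
  then show ?thesis using that s by blast
qed

section \<open>Successive constrained maximization\<close>

lemma SUP_eq_arg_max:
  fixes f :: "'a \<Rightarrow> real"
  assumes "is_arg_max f (\<lambda>x. x \<in> S) x"
  shows "(SUP y\<in>S. f y) = f x"
  using assms by (intro cSup_eq_maximum) (auto simp: is_arg_max_linorder)

text \<open>
  The construction without the shift \<open>\<tau>\<close> and the values \<open>\<mu>\<close>.  The maxima must not vanish:
  a zero maximum means that the vectors found so far already span the space.
\<close>

locale successive_maximization = equivalent_inner_product A c K + m: symmetric_form m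
  for A m :: "'a::real_normed_vector \<Rightarrow> 'a \<Rightarrow> real" and c K +
  fixes e :: "nat \<Rightarrow> 'a"
  assumes m_pos: "u \<noteq> 0 \<Longrightarrow> 0 < m u u"
    and arg_max: "is_arg_max (\<lambda>u. m u u) (\<lambda>u. u \<in> constraint_set A e n) (e n)"
    and maximum_nonzero: "m (e n) (e n) \<noteq> 0"
begin

lemma e_nonzero: "e n \<noteq> 0"
  using maximum_nonzero[of n] by (auto simp: m.form_simps)

lemma maximum_pos: "0 < m (e n) (e n)"
  using m_pos e_nonzero .

lemma maximal: "u \<in> constraint_set A e n \<Longrightarrow> m u u \<le> m (e n) (e n)"
  using arg_max[of n] by (simp add: is_arg_max_linorder)

lemma e_in_constraint_set: "e n \<in> constraint_set A e n"
  using arg_max[of n] by (simp add: is_arg_max_def)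

lemma maximum_decreasing: "i \<le> j \<Longrightarrow> m (e j) (e j) \<le> m (e i) (e i)"
  using e_in_constraint_set[of j] by (intro maximal) (auto simp: constraint_set_def)

lemma Rayleigh:
  assumes "\<And>k. k < n \<Longrightarrow> A u (e k) = 0"
  shows "m u u \<le> m (e n) (e n) * A u u"
proof (cases "u = 0")
  case True
  then show ?thesis by (simp add: form_simps m.form_simps)
next
  case False
  then have A: "0 < A u u" by (rule pos)
  define r where "r = 1 / sqrt (A u u)"
  have r2: "r * (r * x) = x / A u u" for x
    using A by (simp add: r_def)
  have "r *\<^sub>R u \<in> constraint_set A e n"
    using assms A by (simp add: constraint_set_def form_simps r2)
  then have "m (r *\<^sub>R u) (r *\<^sub>R u) \<le> m (e n) (e n)" by (rule maximal)
  then have "m u u / A u u \<le> m (e n) (e n)" by (simp add: m.form_simps r2)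
  then show ?thesis
    using A by (simp add: pos_divide_le_eq)
qed

lemma orthonormal: "A (e i) (e j) = (if i = j then 1 else 0)"
proof -
  have "A (e n) (e n) = 1" for n
  proof (rule antisym)
    show "A (e n) (e n) \<le> 1"
      using e_in_constraint_set[of n] by (simp add: constraint_set_def)
    show "1 \<le> A (e n) (e n)"
      using Rayleigh[of n "e n"] e_in_constraint_set[of n] maximum_pos[of n]
      by (simp add: constraint_set_def)
  qed
  moreover have "A (e j) (e k) = 0" if "k < j" for j k
    using e_in_constraint_set[of j] that by (simp add: constraint_set_def)
  ultimately show ?thesis
    using commute[of "e i" "e j"] by (cases i j rule: linorder_cases) auto
qed

sublocale orthonormal_sequence A c K e
  by unfold_locales (rule orthonormal)

text \<open>
  The form \<open>M n A - m\<close> is nonnegative on the constraint space and vanishes at \<open>e n\<close>, so by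
  Cauchy-Schwarz it pairs \<open>e n\<close> with every vector of that space to zero.
\<close>

lemma euler_lagrange_constrained:
  assumes v: "\<And>k. k < n \<Longrightarrow> A v (e k) = 0"
  shows "m (e n) v = m (e n) (e n) * A (e n) v"
proof -
  define q where "q u v = m (e n) (e n) * A u v + (- 1) * m u v" for u v
  define W where "W = {u. \<forall>k<n. A u (e k) = 0}"
  have "symmetric_bilinear_form q"
    unfolding q_def
    by (rule symmetric_bilinear_form_combination[OF symmetric_bilinear m.symmetric_bilinear])
  then interpret q: symmetric_form q by unfold_locales
  have "subspace W"
    by (auto simp: W_def subspace_def form_simps)
  moreover have "0 \<le> q u u" if "u \<in> W" for u
    using Rayleigh[of n u] that by (simp add: W_def q_def)
  moreover have "e n \<in> W" "v \<in> W"
    using v by (auto simp: W_def orthonormal)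
  ultimately have "(q (e n) v)\<^sup>2 \<le> q (e n) (e n) * q v v"
    by (rule q.Cauchy_Schwarz_on)
  moreover have "q (e n) (e n) = 0"
    by (simp add: q_def orthonormal)
  ultimately have "q (e n) v = 0" by simp
  then show ?thesis by (simp add: q_def)
qed

text \<open>
  To remove the constraint, subtract from \<open>v\<close> its projection onto \<open>e 0, \<dots>, e (n - 1)\<close>.  The
  projection contributes nothing to either side, because \<open>e n\<close> is admissible in every earlier step
  \<open>k\<close> and the constrained equation of that step gives \<open>m (e k) (e n) = M k A (e k) (e n) = 0\<close>.
\<close>

lemma euler_lagrange: "m (e n) v = m (e n) (e n) * A (e n) v"
proof -
  define p where "p = (\<Sum>k<n. A v (e k) *\<^sub>R e k)"
  have earlier: "m (e k) (e n) = 0" if "k < n" for k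
    using euler_lagrange_constrained[of k "e n"] that by (simp add: orthonormal)
  have "m p (e n) = 0" "A p (e n) = 0"
    by (simp_all add: p_def m.sum_left sum_left earlier orthonormal)
  moreover have "m (e n) (v - p) = m (e n) (e n) * A (e n) (v - p)"
    by (rule euler_lagrange_constrained) (simp add: p_def form_simps coefficient)
  ultimately show ?thesis
    by (simp add: form_simps m.form_simps commute[of "e n" p] m.commute[of "e n" p])
qed

lemma maximum_tendsto_zero:
  assumes "weakly_continuous_form m"
  shows "(\<lambda>n. m (e n) (e n)) \<longlonglongrightarrow> 0"
proof -
  have "(\<lambda>n. m (e n) (e n)) \<longlonglongrightarrow> m 0 0"
    using assms weakly_converges_zero unfolding weakly_continuous_form_def by blast
  then show ?thesis by (simp add: m.form_simps)
qed

lemma orthogonal_to_all_imp_zero: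
  assumes wc: "weakly_continuous_form m" and w: "\<And>k. A w (e k) = 0"
  shows "w = 0"
proof -
  have "(\<lambda>n. m (e n) (e n) * A w w) \<longlonglongrightarrow> 0"
    using maximum_tendsto_zero[OF wc] by (rule tendsto_mult_left_zero)
  then have "m w w \<le> 0"
    by (rule LIMSEQ_le_const) (use Rayleigh w in blast)
  then show ?thesis using m_pos[of w] by fastforce
qed

lemma span_dense:
  assumes "complete (UNIV :: 'a set)" and "weakly_continuous_form m"
  shows "closure (span (range e)) = UNIV"
proof -
  have "u \<in> closure (span (range e))" for u
  proof -
    obtain s where lim: "(\<lambda>n. \<Sum>k<n. A u (e k) *\<^sub>R e k) \<longlonglongrightarrow> s"
      and coeff: "\<And>j. A s (e j) = A u (e j)"
      using Fourier_series_convergent[OF assms(1)] by blast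
    have "u - s = 0"
      by (rule orthogonal_to_all_imp_zero[OF assms(2)]) (simp add: form_simps coeff)
    moreover have "(\<Sum>k<n. A u (e k) *\<^sub>R e k) \<in> span (range e)" for n
      by (intro span_sum span_scale span_base) auto
    ultimately show ?thesis
      using lim unfolding closure_sequential by (metis eq_iff_diff_eq_0)
  qed
  then show ?thesis by blast
qed

text \<open>
  Testing \<open>m u v = \<nu> A u v\<close> with \<open>v = e k\<close> and comparing with the Euler-Lagrange equation gives
  \<open>\<nu> A u (e k) = M k A u (e k)\<close>.  Hence only the coefficients with \<open>M k = \<nu>\<close> survive, and these are
  finitely many since \<open>M\<close> tends to \<open>0 \<noteq> \<nu>\<close>.
\<close>

lemma finite_multiplicity:
  assumes wc: "weakly_continuous_form m" and \<nu>: "\<nu> \<noteq> 0"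
  shows "finite_dimensional {u. \<forall>v. m u v = \<nu> * A u v}"
proof -
  define F where "F = {k. m (e k) (e k) = \<nu>}"
  let ?E = "{u. \<forall>v. m u v = \<nu> * A u v}"
  have "\<forall>\<^sub>F k in sequentially. m (e k) (e k) \<noteq> \<nu>"
    using \<nu> by (intro tendsto_imp_eventually_ne[OF maximum_tendsto_zero[OF wc]]) simp
  then have F: "finite F"
    unfolding F_def cofinite_eq_sequentially[symmetric] eventually_cofinite by simp
  have "subspace ?E"
    by (auto simp: subspace_def form_simps m.form_simps algebra_simps)
  moreover have "e ` F \<subseteq> ?E"
    unfolding F_def using euler_lagrange by blast
  ultimately have "span (e ` F) \<subseteq> ?E"
    by (simp add: span_minimal)
  moreover have "u \<in> span (e ` F)" if u: "\<forall>v. m u v = \<nu> * A u v" for u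
  proof -
    have vanish: "A u (e k) = 0" if "k \<notin> F" for k
    proof -
      have "\<nu> * A u (e k) = m (e k) (e k) * A u (e k)"
        using spec[OF u, of "e k"] euler_lagrange[of k u] commute[of u "e k"] m.commute[of u "e k"]
        by metis
      then show ?thesis using that by (simp add: F_def)
    qed
    have "u - (\<Sum>k\<in>F. A u (e k) *\<^sub>R e k) = 0"
      by (rule orthogonal_to_all_imp_zero[OF wc]) (simp add: form_simps coefficient F vanish)
    then have "u = (\<Sum>k\<in>F. A u (e k) *\<^sub>R e k)"
      by (simp only: right_minus_eq)
    also have "\<dots> \<in> span (e ` F)"
      by (intro span_sum span_scale span_base) auto
    finally show ?thesis .
  qed
  ultimately have "span (e ` F) = ?E" by blast
  then show ?thesis
    using F unfolding finite_dimensional_def by blast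
qed

end

section \<open>The spectral theorem\<close>

theorem theorem4p2:
  fixes a b m :: "'a::{real_inner, complete_space} \<Rightarrow> 'a \<Rightarrow> real"
    and lam \<tau> :: real
    and e :: "nat \<Rightarrow> 'a"
    and \<mu> :: "nat \<Rightarrow> real"
  assumes "separable_space (euclidean :: 'a topology)"
    and "symmetric_bilinear_form a"
    and "symmetric_bilinear_form b"
    and "symmetric_bilinear_form m"
    and "continuous_coercive a"
    and "weakly_continuous_form b"
    and "weakly_continuous_form m"
    and "\<And>u. u \<noteq> 0 \<Longrightarrow> m u u > 0"
    and "\<tau> > 0"
    and "\<And>u. shifted_form a b m lam \<tau> u u \<ge> 1 / 2 * a u u"
    and "iterative_construction (shifted_form a b m lam \<tau>) m \<tau> e \<mu>"
  shows "(\<forall>n. finite_dimensional (eigenspace a b m lam (\<mu> n)))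
    \<and> - \<infinity> < ereal (\<mu> 0) \<and> incseq \<mu> \<and> filterlim \<mu> at_top sequentially
    \<and> form_orthonormal_basis (shifted_form a b m lam \<tau>) e
    \<and> (\<forall>n v. a (e n) v = lam * b (e n) v + \<mu> n * m (e n) v)"
proof -
  define A where "A = shifted_form a b m lam \<tau>"
  have A_eq: "A u v = a u v - lam * b u v + \<tau> * m u v" for u v
    by (simp add: A_def shifted_form_def)
  obtain c\<^sub>1 c\<^sub>2 where c: "0 < c\<^sub>1" "\<And>u. c\<^sub>1 * (norm u)\<^sup>2 \<le> a u u" "\<And>u. a u u \<le> c\<^sub>2 * (norm u)\<^sup>2"
    using assms(5) unfolding continuous_coercive_def by blast
  obtain K\<^sub>b where Kb: "\<And>u. \<bar>b u u\<bar> \<le> K\<^sub>b * (norm u)\<^sup>2"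
    using weakly_continuous_form_bounded[OF assms(3,6)] by blast
  obtain K\<^sub>m where Km: "\<And>u. \<bar>m u u\<bar> \<le> K\<^sub>m * (norm u)\<^sup>2"
    using weakly_continuous_form_bounded[OF assms(4,7)] by blast
  have coercive: "c\<^sub>1 / 2 * (norm u)\<^sup>2 \<le> A u u" for u
    using assms(10)[of u] c(2)[of u] by (simp add: A_def)
  have bounded: "A u u \<le> (c\<^sub>2 + \<bar>lam\<bar> * K\<^sub>b + \<tau> * K\<^sub>m) * (norm u)\<^sup>2" for u
  proof -
    have "- (lam * b u u) \<le> \<bar>lam\<bar> * \<bar>b u u\<bar>"
      by (metis abs_ge_minus_self abs_mult)
    also have "\<dots> \<le> \<bar>lam\<bar> * (K\<^sub>b * (norm u)\<^sup>2)"
      by (intro mult_left_mono Kb) simp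
    finally have "- (lam * b u u) \<le> \<bar>lam\<bar> * (K\<^sub>b * (norm u)\<^sup>2)" .
    moreover have "\<tau> * m u u \<le> \<tau> * (K\<^sub>m * (norm u)\<^sup>2)"
      using Km[of u] assms(9) by (intro mult_left_mono) auto
    ultimately show ?thesis
      using c(3)[of u] by (simp add: A_eq algebra_simps)
  qed
  have steps: "is_arg_max (\<lambda>u. m u u) (\<lambda>u. u \<in> constraint_set A e n) (e n)"
    "\<mu> n + \<tau> \<noteq> 0" "1 / (\<mu> n + \<tau>) = (SUP u\<in>constraint_set A e n. m u u)" for n
    using assms(11) unfolding iterative_construction_def A_def by auto
  have maximum: "m (e n) (e n) = 1 / (\<mu> n + \<tau>)" for n
    using steps(3)[of n] SUP_eq_arg_max[OF steps(1)[of n]] by simp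
  interpret successive_maximization A m "c\<^sub>1 / 2" "c\<^sub>2 + \<bar>lam\<bar> * K\<^sub>b + \<tau> * K\<^sub>m" e
  proof
    show "symmetric_bilinear_form A"
      unfolding A_def using assms(2-4) by (rule symmetric_bilinear_form_shifted)
    show "m (e n) (e n) \<noteq> 0" for n
      using steps(2)[of n] by (simp add: maximum)
  qed (use c(1) coercive bounded assms(4,8) steps(1) in auto)
  have shift_pos: "0 < \<mu> n + \<tau>" for n
    using maximum_pos[of n] by (simp add: maximum)
  have eigen_eq: "m u v = 1 / (\<mu> n + \<tau>) * A u v \<longleftrightarrow> a u v - lam * b u v = \<mu> n * m u v"
    for n u v
    using shift_pos[of n] by (auto simp: A_eq field_simps)

  have "finite_dimensional (eigenspace a b m lam (\<mu> n))" for n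
    using finite_multiplicity[OF assms(7), of "1 / (\<mu> n + \<tau>)"] steps(2)[of n]
    unfolding eigenspace_def eigen_eq by simp
  moreover have "incseq \<mu>"
  proof (rule incseq_SucI)
    fix n
    have "1 / (\<mu> (Suc n) + \<tau>) \<le> 1 / (\<mu> n + \<tau>)"
      using maximum_decreasing[of n "Suc n"] by (simp add: maximum)
    then show "\<mu> n \<le> \<mu> (Suc n)"
      using shift_pos[of n] shift_pos[of "Suc n"] by (simp add: field_simps)
  qed
  moreover have "filterlim \<mu> at_top sequentially"
  proof -
    have "filterlim (\<lambda>n. inverse (m (e n) (e n))) at_top sequentially"
      by (intro filterlim_inverse_at_top maximum_tendsto_zero assms(7) always_eventually
          allI maximum_pos)
    then have "filterlim (\<lambda>n. - \<tau> + (\<mu> n + \<tau>)) at_top sequentially"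
      by (intro filterlim_tendsto_add_at_top[OF tendsto_const]) (simp add: maximum)
    then show ?thesis by simp
  qed
  moreover have "form_orthonormal_basis A e"
    unfolding form_orthonormal_basis_def
    using orthonormal span_dense[OF complete_UNIV assms(7)] by simp
  moreover have "a (e n) v = lam * b (e n) v + \<mu> n * m (e n) v" for n v
    using euler_lagrange[of n v] eigen_eq[of "e n" v n] by (simp add: maximum)
  ultimately show ?thesis
    by (simp add: A_def)
qed

end
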